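(* Fix an integer $c\ge2$ and a finite list of integers $L_1,\dots,L_r$ with $L_i\ge2$ for all $i$. Then for all sufficiently large integers $t$ (i.e. there is $t_0$, depending on $c,L_1,\dots,L_r$, such that for every $t\ge t_0$), the spider tree $$S(c,L_1,\dots,L_r,1^t)$$ has a graceful labeling in which the hub has label $1$.
   Context: A graceful labeling of a tree with $n$ vertices is a bijection $f$ from its vertices to $\{0,1,\dots,n-1\}$ such that the set of values $|f(u)-f(v)|$ over edges $uv$ equals $\{1,2,\dots,n-1\}$. The spider tree $S(\ell_1,\dots,\ell_k)$ is obtained from a central hub vertex by attaching $k$ paths (arms) at the hub, where $\ell_i$ is the number of edges of the $i$-th arm; it has $1+\sum_i\ell_i$ vertices. The notation $1^t$ means that there are $t$ further arms of length $1$ (leaves adjacent to the hub). *)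

theory Defs
  imports Main
begin

(* A finite simple graph is given by its vertex set V and its set E of two-element
   edges {u, v}.  A labeling is only relevant on V. *)
definition graceful_labeling :: "'a set \<Rightarrow> 'a set set \<Rightarrow> ('a \<Rightarrow> nat) \<Rightarrow> bool" where
  "graceful_labeling V E f \<longleftrightarrow>
     bij_betw f V {0..<card V} \<and>
     {\<bar>int (f u) - int (f v)\<bar> | u v. {u, v} \<in> E} = {1..int (card V) - 1}"

(* Arm i j is the vertex at distance j >= 1 from the hub on the i-th arm (i counted from 0). *)
datatype spider_vertex = Hub | Arm nat nat

(* The list ls contains the numbers of edges of the arms. *)
definition spider_verts :: "nat list \<Rightarrow> spider_vertex set" where
  "spider_verts ls = {Hub} \<union> {Arm i j | i j. i < length ls \<and> 1 \<le> j \<and> j \<le> ls ! i}"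

definition spider_edges :: "nat list \<Rightarrow> spider_vertex set set" where
  "spider_edges ls =
     {{Hub, Arm i 1} | i. i < length ls \<and> 1 \<le> ls ! i} \<union>
     {{Arm i j, Arm i (j + 1)} | i j. i < length ls \<and> 1 \<le> j \<and> j + 1 \<le> ls ! i}"

lemma spider_verts_eq:
  "spider_verts ls = insert Hub (case_prod Arm ` (SIGMA i:{..<length ls}. {1..ls ! i}))"
  unfolding spider_verts_def by force

lemma finite_spider_verts: "finite (spider_verts ls)"
  unfolding spider_verts_eq by simp

lemma card_spider_verts: "card (spider_verts ls) = 1 + sum_list ls"
proof -
  have inj: "inj_on (case_prod Arm) (SIGMA i:{..<length ls}. {1..ls ! i})"
    by (auto simp: inj_on_def)
  have "card (case_prod Arm ` (SIGMA i:{..<length ls}. {1..ls ! i})) = sum_list ls"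
    unfolding card_image[OF inj] by (simp add: sum_list_sum_nth atLeast0LessThan)
  moreover have "Hub \<notin> case_prod Arm ` (SIGMA i:{..<length ls}. {1..ls ! i})"
    by auto
  ultimately show ?thesis
    unfolding spider_verts_eq by (simp add: card_insert_if)
qed

end

theory Submission
  imports Defs
begin

text \<open>
  Measure all labels relative to the hub, so that the hub has label \<open>0\<close> and, with \<open>N\<close> edges in
  total, the other labels are \<open>-1\<close> and \<open>1, \<dots>, N - 1\<close>. A leaf at the hub labelled \<open>y > 0\<close> contributes
  the difference \<open>y\<close>, so the leaves may take all labels not used by the long arms as soon as the
  differences on each long arm are exactly its own labels, except that the arm containing \<open>-1\<close>
  contributes \<open>N\<close> in place of \<open>-1\<close>. Geometric arms \<open>2^(l-1) b, \<dots>, 2 b, b\<close> have this property and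
  serve for the lengths \<open>L\<^sub>i\<close>. The arm of length \<open>c\<close> is \<open>N - 1, -1\<close> followed by a tail of \<open>c - 2\<close>
  labels which does not depend on \<open>N\<close>; no such tail of length \<open>1\<close> exists, and for \<open>c = 3\<close> the arm
  \<open>N - 2, -1, N - 1\<close> is used.
\<close>

section \<open>Labels relative to the hub and their edge differences\<close>

fun pdiffs :: "int list \<Rightarrow> int set" where
  "pdiffs (x # y # ys) = insert \<bar>x - y\<bar> (pdiffs (y # ys))"
| "pdiffs _ = {}"

lemma pdiffs_conv_nth: "pdiffs xs = (\<lambda>j. \<bar>xs ! j - xs ! Suc j\<bar>) ` {..<length xs - 1}"
  by (induction xs rule: pdiffs.induct) (simp_all add: lessThan_Suc_eq_insert_0 image_image)

text \<open>Each list in \<open>xss\<close> runs outward from the hub. Prepending the hub label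
  \<open>0\<close> makes positions agree with distances, so the edge at the hub is simply the first
  consecutive pair.\<close>

definition arm_label :: "int list list \<Rightarrow> spider_vertex \<Rightarrow> int" where
  "arm_label xss v = (case v of Hub \<Rightarrow> 0 | Arm i j \<Rightarrow> (0 # xss ! i) ! j)"

lemma arm_label_image:
  "arm_label xss ` spider_verts (map length xss) = set (0 # concat xss)"
proof -
  have set_arm: "(\<lambda>j. (0 # ys) ! j) ` {1..length ys} = set ys" for ys :: "int list"
  proof -
    have "{1..length ys} = Suc ` {..<length ys}"
      by (simp add: image_Suc_lessThan)
    then show ?thesis
      by (auto simp: image_image set_conv_nth)
  qed
  have image_Arm: "f ` case_prod Arm ` Sigma A B = (\<Union>i\<in>A. (\<lambda>j. f (Arm i j)) ` B i)"
    for f :: "spider_vertex \<Rightarrow> int" and A B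
    by force
  have "arm_label xss ` spider_verts (map length xss)
      = insert 0 (\<Union>i<length xss. (\<lambda>j. (0 # xss ! i) ! j) ` {1..length (xss ! i)})"
    unfolding spider_verts_eq image_insert image_Arm by (simp add: arm_label_def)
  also have "\<dots> = insert 0 (\<Union>i<length xss. set (xss ! i))"
    by (simp only: set_arm)
  also have "(\<Union>i<length xss. set (xss ! i)) = \<Union> (set ` set xss)"
    by (auto simp: set_conv_nth[of xss])
  finally show ?thesis by simp
qed

lemma arm_label_edge_differences:
  "{\<bar>arm_label xss u - arm_label xss v\<bar> | u v. {u, v} \<in> spider_edges (map length xss)}
    = (\<Union>ys\<in>set xss. pdiffs (0 # ys))" (is "?L = ?R")
proof
  show "?L \<subseteq> ?R"
  proof
    fix d assume "d \<in> ?L"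
    then obtain u v where d: "d = \<bar>arm_label xss u - arm_label xss v\<bar>"
      and uv: "{u, v} \<in> spider_edges (map length xss)" by auto
    have "\<exists>i j. i < length xss \<and> Suc j < length (0 # xss ! i)
        \<and> d = \<bar>(0 # xss ! i) ! j - (0 # xss ! i) ! Suc j\<bar>"
      using uv unfolding spider_edges_def
    proof (elim UnE CollectE exE conjE)
      fix i assume i: "i < length (map length xss)" "1 \<le> map length xss ! i"
        and "{u, v} = {Hub, Arm i 1}"
      then have "d = \<bar>(0 # xss ! i) ! 0 - (0 # xss ! i) ! Suc 0\<bar>"
        using d by (elim doubleton_eq_iff[THEN iffD1, elim_format] disjE) (simp_all add: arm_label_def)
      with i show ?thesis by - (rule exI[of _ i], rule exI[of _ 0], auto)
    next
      fix i j assume i: "i < length (map length xss)" "1 \<le> j" "j + 1 \<le> map length xss ! i"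
        and "{u, v} = {Arm i j, Arm i (j + 1)}"
      then have "d = \<bar>(0 # xss ! i) ! j - (0 # xss ! i) ! Suc j\<bar>"
        using d by (elim doubleton_eq_iff[THEN iffD1, elim_format] disjE)
          (simp_all add: arm_label_def abs_minus_commute)
      with i show ?thesis by - (rule exI[of _ i], rule exI[of _ j], simp)
    qed
    then obtain i j where "i < length xss" "Suc j < length (0 # xss ! i)"
      "d = \<bar>(0 # xss ! i) ! j - (0 # xss ! i) ! Suc j\<bar>" by blast
    then have "xss ! i \<in> set xss" "d \<in> pdiffs (0 # xss ! i)"
      unfolding pdiffs_conv_nth by auto
    then show "d \<in> ?R" by blast
  qed
next
  show "?R \<subseteq> ?L"
  proof
    fix d assume "d \<in> ?R"
    then obtain i j where i: "i < length xss" and j: "Suc j < length (0 # xss ! i)"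
      and d: "d = \<bar>(0 # xss ! i) ! j - (0 # xss ! i) ! Suc j\<bar>"
      by (auto simp: pdiffs_conv_nth set_conv_nth[of xss])
    show "d \<in> ?L"
    proof (cases "j = 0")
      case True
      then have "{Hub, Arm i 1} \<in> spider_edges (map length xss)"
        using i j unfolding spider_edges_def
        by - (rule UnI1, rule CollectI, rule exI[of _ i], simp add: Suc_le_eq)
      moreover have "d = \<bar>arm_label xss Hub - arm_label xss (Arm i 1)\<bar>"
        using d True by (simp add: arm_label_def)
      ultimately show ?thesis by blast
    next
      case False
      then have "{Arm i j, Arm i (j + 1)} \<in> spider_edges (map length xss)"
        using i j unfolding spider_edges_def
        by - (rule UnI2, rule CollectI, rule exI[of _ i], rule exI[of _ j], simp)
      moreover have "d = \<bar>arm_label xss (Arm i j) - arm_label xss (Arm i (j + 1))\<bar>"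
        using d by (simp add: arm_label_def)
      ultimately show ?thesis by blast
    qed
  qed
qed

text \<open>The shift by \<open>a\<close> moves the smallest label to \<open>0\<close>. Injectivity
  follows by counting: the labels fill an interval with as many elements as there are
  vertices.\<close>

lemma graceful_labeling_of_arms:
  fixes a :: nat
  assumes labels: "set (0 # concat xss) = {- int a..int (length (concat xss)) - int a}"
    and diffs: "(\<Union>ys\<in>set xss. pdiffs (0 # ys)) = {1..int (length (concat xss))}"
  shows "graceful_labeling (spider_verts (map length xss)) (spider_edges (map length xss))
           (\<lambda>v. nat (arm_label xss v + int a))"
proof -
  let ?V = "spider_verts (map length xss)" and ?E = "spider_edges (map length xss)"
  let ?f = "\<lambda>v. nat (arm_label xss v + int a)"
  define N where "N = length (concat xss)"
  have card: "card ?V = Suc N"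
    by (simp add: card_spider_verts N_def length_concat)
  have lab: "arm_label xss ` ?V = {- int a..int N - int a}"
    unfolding arm_label_image N_def by (rule labels)
  \<comment> \<open>On vertices the relative label is at least \<open>- int a\<close>, so
    \<open>nat\<close> does not truncate.\<close>
  have int_f: "int (?f v) = arm_label xss v + int a" if "v \<in> ?V" for v
    using that lab by force
  have "?f ` ?V = (\<lambda>x. nat (x + int a)) ` {- int a..int N - int a}"
    unfolding lab[symmetric] by (simp add: image_image)
  also have "\<dots> = {0..<card ?V}"
  proof
    show "{0..<card ?V} \<subseteq> (\<lambda>x. nat (x + int a)) ` {- int a..int N - int a}"
    proof
      fix n assume "n \<in> {0..<card ?V}"
      then show "n \<in> (\<lambda>x. nat (x + int a)) ` {- int a..int N - int a}"
        unfolding card by (intro image_eqI[of _ _ "int n - int a"]) auto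
    qed
  qed (auto simp: card)
  finally have img: "?f ` ?V = {0..<card ?V}" .
  then have "inj_on ?f ?V"
    by (intro eq_card_imp_inj_on finite_spider_verts) simp
  with img have bij: "bij_betw ?f ?V {0..<card ?V}"
    by (simp add: bij_betw_def)
  have edge_verts: "u \<in> ?V \<and> v \<in> ?V" if "{u, v} \<in> ?E" for u v
    using that unfolding spider_edges_def spider_verts_def
    by (auto simp: doubleton_eq_iff)
  have "\<bar>int (?f u) - int (?f v)\<bar> = \<bar>arm_label xss u - arm_label xss v\<bar>" if "{u, v} \<in> ?E" for u v
    using edge_verts[OF that] by (simp add: int_f del: int_nat_eq)
  then have "{\<bar>int (?f u) - int (?f v)\<bar> | u v. {u, v} \<in> ?E}
      = {\<bar>arm_label xss u - arm_label xss v\<bar> | u v. {u, v} \<in> ?E}"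
    by (metis (no_types, lifting))
  then show ?thesis
    unfolding graceful_labeling_def using bij
    by (simp only: arm_label_edge_differences diffs) (simp add: card N_def)
qed

section \<open>Arms with geometric labels\<close>

fun geom :: "nat \<Rightarrow> int \<Rightarrow> int list" where
  "geom 0 b = []"
| "geom (Suc n) b = 2 ^ n * b # geom n b"

lemma length_geom [simp]: "length (geom n b) = n"
  by (induction n) auto

lemma geom_bounds: "0 < b \<Longrightarrow> x \<in> set (geom n b) \<Longrightarrow> b \<le> x \<and> x < 2 ^ n * b"
proof (induction n)
  case (Suc n)
  have "b * 1 \<le> b * 2 ^ n" using Suc.prems by (intro mult_left_mono) auto
  then show ?case using Suc by (auto simp: mult.commute)
qed simp

lemma distinct_geom: "0 < b \<Longrightarrow> distinct (geom n b)"
  by (induction n) (auto dest: geom_bounds)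

text \<open>Each term is twice the next, so two neighbours differ by the smaller one.\<close>

lemma pdiffs_Cons_geom: "0 < b \<Longrightarrow> pdiffs (2 ^ n * b # geom n b) = set (geom n b)"
  by (induction n) auto

text \<open>For positive \<open>n\<close> the first label lies midway between \<open>0\<close> and
  \<open>2 ^ n * b\<close>, so starting from \<open>0\<close> gives the same differences.\<close>

lemma pdiffs_zero_geom: "0 < b \<Longrightarrow> pdiffs (0 # geom n b) = set (geom n b)"
  using pdiffs_Cons_geom by (cases n) auto

text \<open>The arms occupy successive blocks: the first has smallest label \<open>K + 1\<close>,
  and the later ones lie above \<open>2 ^ l * (K + 1)\<close>. Labels up to \<open>K\<close> stay
  reserved for the arm containing \<open>-1\<close>.\<close>

lemma geometric_arms:
  assumes "0 \<le> K"
  shows "\<exists>xss B. map length xss = Ls \<and> distinct (concat xss) \<and> K \<le> B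
    \<and> set (concat xss) \<subseteq> {K<..B} \<and> (\<Union>ys\<in>set xss. pdiffs (0 # ys)) = set (concat xss)"
  using assms
proof (induction Ls arbitrary: K)
  case Nil
  show ?case by (intro exI[of _ "[]"] exI[of _ K]) auto
next
  case (Cons l Ls)
  let ?g = "geom l (K + 1)"
  define K' where "K' = 2 ^ l * (K + 1)"
  have g: "K < x \<and> x < K'" if "x \<in> set ?g" for x
    using geom_bounds[OF _ that] Cons.prems unfolding K'_def by linarith
  have "1 * (K + 1) \<le> K'" unfolding K'_def using Cons.prems by (intro mult_right_mono) auto
  then have K': "K < K'" by simp
  with Cons.prems have "0 \<le> K'" by simp
  from Cons.IH[OF this] obtain xss B where xss: "map length xss = Ls" "distinct (concat xss)"
    "K' \<le> B" "set (concat xss) \<subseteq> {K'<..B}"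
    "(\<Union>ys\<in>set xss. pdiffs (0 # ys)) = set (concat xss)"
    by blast
  show ?case
  proof (intro exI[of _ "?g # xss"] exI[of _ B] conjI)
    have "set ?g \<inter> {K'<..B} = {}" using g by (auto dest!: g)
    then have "set ?g \<inter> set (concat xss) = {}" using xss(4) by blast
    then show "distinct (concat (?g # xss))"
      using xss(2) distinct_geom[of "K + 1" l] Cons.prems by simp
    have "set ?g \<subseteq> {K<..B}" using xss(3) by (auto dest!: g)
    moreover have "{K'<..B} \<subseteq> {K<..B}" using K' by auto
    ultimately have "set ?g \<union> set (concat xss) \<subseteq> {K<..B}" using xss(4) by blast
    then show "set (concat (?g # xss)) \<subseteq> {K<..B}" by simp
    show "(\<Union>ys\<in>set (?g # xss). pdiffs (0 # ys)) = set (concat (?g # xss))"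
      using xss(5) pdiffs_zero_geom[of "K + 1" l] Cons.prems by simp
  qed (use xss K' in auto)
qed

section \<open>The arm containing the label \<open>-1\<close>\<close>

text \<open>Such a list continues the arm beyond \<open>-1\<close>. For \<open>m = 1\<close> the
  only difference would be \<open>w + 1\<close>, not \<open>w\<close>. Lengths below 8 are given
  explicitly; from 8 on, eight labels depending on a power of two are followed by repeated
  halving.\<close>

lemma tail_exists:
  assumes "m \<noteq> 1"
  shows "\<exists>ws. length ws = m \<and> distinct ws \<and> (\<forall>w\<in>set ws. 0 < w) \<and> pdiffs (-1 # ws) = set ws"
proof (cases "m < 8")
  case True
  with assms consider "m = 0" | "m = 2" | "m = 3" | "m = 4" | "m = 5" | "m = 6" | "m = 7"
    by linarith
  then show ?thesis
  proof cases
    case 1 then show ?thesis by (intro exI[of _ "[]"]) auto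
  next
    case 2 then show ?thesis by (intro exI[of _ "[1, 2]"]) auto
  next
    case 3 then show ?thesis by (intro exI[of _ "[2, 3, 1]"]) auto
  next
    case 4 then show ?thesis by (intro exI[of _ "[3, 2, 4, 1]"]) auto
  next
    case 5 then show ?thesis by (intro exI[of _ "[5, 1, 6, 3, 4]"]) auto
  next
    case 6 then show ?thesis by (intro exI[of _ "[5, 1, 6, 3, 4, 2]"]) auto
  next
    case 7 then show ?thesis by (intro exI[of _ "[7, 1, 8, 4, 6, 3, 2]"]) auto
  qed
next
  case False
  define q where "q = m - 8"
  define p :: int where "p = 2 ^ q"
  have p: "1 \<le> p" by (simp add: p_def)
  \<comment> \<open>\<open>2k - 1, k - 1, k, 1, 2k\<close> is a tail for every \<open>k\<close>. A tail ending in \<open>s\<close> may be extended by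
    \<open>z, s - z, s - 2z\<close>, and, if \<open>s\<close> is even, by \<open>s / 2\<close>. Here \<open>k = 10p\<close>, \<open>z = 8p\<close>, and
    \<open>s - 2z = 4p\<close> is halved down to \<open>4\<close>.\<close>
  let ?g = "geom q 4"
  let ?w = "[20*p - 1, 10*p - 1, 10*p, 1, 20*p, 8*p, 12*p, 4*p]"
  have g: "4 \<le> x \<and> x < 4 * p" if "x \<in> set ?g" for x
    using geom_bounds[OF _ that] by (simp add: p_def mult.commute)
  have "pdiffs (-1 # ?w @ ?g) = insert (20*p) (insert (10*p) (insert 1 (insert (10*p - 1)
      (insert (20*p - 1) (insert (12*p) (insert (4*p) (insert (8*p) (pdiffs (4*p # ?g)))))))))"
    using p by simp
  also have "pdiffs (4*p # ?g) = set ?g"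
    using pdiffs_Cons_geom[of 4 q] by (simp add: p_def mult.commute)
  finally have "pdiffs (-1 # ?w @ ?g) = set (?w @ ?g)"
    by (simp only: set_append list.set) blast
  moreover have "distinct (?w @ ?g)"
  proof -
    \<comment> \<open>The entry \<open>1\<close> lies below this interval, and all other entries are
      at least \<open>4*p\<close>.\<close>
    have "set ?w \<inter> {4..<4*p} = {}" using p by auto
    then have "set ?w \<inter> set ?g = {}" using g by fastforce
    moreover have "distinct ?w" using p by auto
    ultimately show ?thesis by (simp add: distinct_geom)
  qed
  moreover have "\<forall>w\<in>set (?w @ ?g). 0 < w"
    using p by (auto dest!: g)
  moreover have "length (?w @ ?g) = m" using False by (simp add: q_def)
  ultimately show ?thesis by blast
qed

text \<open>In the arm \<open>N - 1, -1\<close> with tail, the first two differences are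
  \<open>N - 1\<close> and \<open>N\<close>, and the tail accounts for itself. Since
  \<open>K\<close> is fixed before \<open>N\<close>, the other arms can be placed above
  \<open>K\<close> before \<open>t\<close> is known.\<close>

lemma first_arm_exists:
  assumes "2 \<le> c"
  shows "\<exists>K\<ge>0. \<forall>N>K + 3. \<exists>ys. length ys = c \<and> distinct ys \<and> -1 \<in> set ys
    \<and> set ys \<subseteq> {-1} \<union> {1..K} \<union> {N - 2..N - 1} \<and> pdiffs (0 # ys) = insert N (set ys - {-1})"
proof (cases "c = 3")
  case True
  show ?thesis
  proof (intro exI[of _ 0] conjI allI impI)
    fix N :: int assume "0 + 3 < N"
    then show "\<exists>ys. length ys = c \<and> distinct ys \<and> -1 \<in> set ys
      \<and> set ys \<subseteq> {-1} \<union> {1..0} \<union> {N - 2..N - 1} \<and> pdiffs (0 # ys) = insert N (set ys - {-1})"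
      \<comment> \<open>The differences are \<open>N - 2\<close>, \<open>N - 1\<close> and
        \<open>N\<close>.\<close>
      using True by (intro exI[of _ "[N - 2, -1, N - 1]"]) auto
  qed simp
next
  case False
  with assms have "c - 2 \<noteq> 1" by linarith
  then obtain ws where ws: "length ws = c - 2" "distinct ws" "\<forall>w\<in>set ws. 0 < w"
      "pdiffs (-1 # ws) = set ws"
    using tail_exists by blast
  \<comment> \<open>Inserting \<open>0\<close> covers the empty tail, which occurs for
    \<open>c = 2\<close>.\<close>
  define K where "K = Max (insert 0 (set ws))"
  have K: "0 \<le> K" "\<And>w. w \<in> set ws \<Longrightarrow> w \<le> K" by (auto simp: K_def)
  show ?thesis
  proof (intro exI[of _ K] conjI allI impI)
    fix N assume N: "K + 3 < N"
    have "set ws \<subseteq> {1..K}" using ws(3) K(2) by fastforce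
    moreover from this have "-1 \<notin> set ws" "N - 1 \<notin> set ws" using N by auto
    ultimately show "\<exists>ys. length ys = c \<and> distinct ys \<and> -1 \<in> set ys
      \<and> set ys \<subseteq> {-1} \<union> {1..K} \<union> {N - 2..N - 1} \<and> pdiffs (0 # ys) = insert N (set ys - {-1})"
      using ws N K(1) assms by (intro exI[of _ "(N - 1) # (-1) # ws"]) auto
  qed (rule K)
qed

section \<open>Combining the arms and labelling the leaves\<close>

theorem corollary3p6:
  fixes c :: nat and Ls :: "nat list"
  assumes "2 \<le> c"
    and "\<forall>l \<in> set Ls. 2 \<le> l"
  shows "\<exists>t0. \<forall>t \<ge> t0. \<exists>f.
           graceful_labeling (spider_verts (c # Ls @ replicate t 1))
                             (spider_edges (c # Ls @ replicate t 1)) f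
           \<and> f Hub = 1"
proof -
  obtain K where K: "0 \<le> K" "\<And>N. K + 3 < N \<Longrightarrow> \<exists>ys. length ys = c \<and> distinct ys \<and> -1 \<in> set ys
      \<and> set ys \<subseteq> {-1} \<union> {1..K} \<union> {N - 2..N - 1} \<and> pdiffs (0 # ys) = insert N (set ys - {-1})"
    using first_arm_exists[OF assms(1)] by blast
  obtain xss B where xss: "map length xss = Ls" "distinct (concat xss)" "K \<le> B"
      "set (concat xss) \<subseteq> {K<..B}" "(\<Union>ys\<in>set xss. pdiffs (0 # ys)) = set (concat xss)"
    using geometric_arms[OF K(1), of Ls] by blast
  show ?thesis
  \<comment> \<open>As \<open>N\<close> is at least \<open>t\<close>, this bound gives
    \<open>B + 3 < N\<close>, which keeps \<open>N - 2\<close> and \<open>N - 1\<close> above all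
    labels of the geometric arms.\<close>
  proof (intro exI[of _ "nat (B + 4)"] allI impI)
    fix t assume t: "nat (B + 4) \<le> t"
    define n where "n = c + sum_list Ls + t"
    define N where "N = int n"
    have N: "B + 3 < N" using t by (simp add: N_def n_def)
    then obtain ys where ys: "length ys = c" "distinct ys" "-1 \<in> set ys"
        "set ys \<subseteq> {-1} \<union> {1..K} \<union> {N - 2..N - 1}" "pdiffs (0 # ys) = insert N (set ys - {-1})"
      using K(2)[of N] xss(3) by auto
    define Y where "Y = set ys \<union> set (concat xss)"
    have "({-1} \<union> {1..K} \<union> {N - 2..N - 1}) \<inter> {K<..B} = {}" using N K(1) by auto
    with ys(4) xss(4) have "set ys \<inter> set (concat xss) = {}" by blast
    then have "card Y = c + sum_list Ls"
      using ys(1,2) xss(1,2) distinct_card[of "ys @ concat xss"]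
      by (simp add: Y_def length_concat)
    have "{-1} \<union> {1..K} \<union> {N - 2..N - 1} \<union> {K<..B} \<subseteq> insert (-1) {1..N - 1}"
      using xss(3) N K(1) by auto
    with ys(3,4) xss(4) have Y: "Y \<subseteq> insert (-1) {1..N - 1}" "-1 \<in> Y"
      unfolding Y_def by blast+
    define R where "R = sorted_list_of_set (insert (-1) {1..N - 1} - Y)"
    have R: "set R = insert (-1) {1..N - 1} - Y" by (simp add: R_def)
    have "length R = card (insert (-1) {1..N - 1}) - card Y"
      unfolding R_def length_sorted_list_of_set
      by (intro card_Diff_subset Y finite_subset[OF Y(1)]) simp
    also have "\<dots> = t"
      unfolding \<open>card Y = _\<close> using N K(1) xss(3) by (simp add: N_def n_def)
    finally have R_length: "length R = t" .
    define zss where "zss = ys # xss @ map (\<lambda>y. [y]) R"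
    have lengths: "map length zss = c # Ls @ replicate t 1"
      using ys(1) xss(1) R_length by (simp add: zss_def o_def map_replicate_const)
    have N_eq: "int (length (concat zss)) = N"
      unfolding length_concat lengths N_def n_def by (simp add: sum_list_replicate)
    have "set (concat zss) = Y \<union> set R"
      by (auto simp: zss_def Y_def)
    also have YR: "Y \<union> set R = insert (-1) {1..N - 1}"
      using R Y by blast
    finally have labels: "set (0 # concat zss) = {- int 1..N - int 1}"
      using N K(1) xss(3) by (simp del: set_concat) auto
    have "(\<Union>ys\<in>set zss. pdiffs (0 # ys)) = insert N (set ys - {-1}) \<union> set (concat xss) \<union> abs ` set R"
      using ys(5) xss(5) by (auto simp: zss_def)
    \<comment> \<open>The only negative label \<open>-1\<close> is already in \<open>Y\<close>, so
      every leaf label is positive and equals its difference to the hub.\<close>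
    also have "abs ` set R = set R"
      unfolding R using Y(2) by (force simp: image_iff)
    also have "insert N (set ys - {-1}) \<union> set (concat xss) \<union> set R = insert N (Y - {-1} \<union> set R)"
    proof -
      have "-1 \<notin> set (concat xss)" using xss(4) K(1) by fastforce
      then show ?thesis unfolding Y_def by blast
    qed
    also have "Y - {-1} \<union> set R = {1..N - 1}"
    proof -
      have "-1 \<notin> set R" using R Y(2) by blast
      then have "Y - {-1} \<union> set R = Y \<union> set R - {-1}" by blast
      then show ?thesis unfolding YR by auto
    qed
    also have "insert N {1..N - 1} = {1..N}"
      using N K(1) xss(3) by auto
    \<comment> \<open>The smallest label is \<open>-1\<close>, so the shift is \<open>1\<close> and
      takes the hub label from \<open>0\<close> to \<open>1\<close>.\<close>
    finally have "graceful_labeling (spider_verts (map length zss)) (spider_edges (map length zss))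
        (\<lambda>v. nat (arm_label zss v + int 1))"
      using labels by (intro graceful_labeling_of_arms) (simp_all only: N_eq)
    moreover have "nat (arm_label zss Hub + int 1) = 1"
      by (simp add: arm_label_def)
    ultimately show "\<exists>f. graceful_labeling (spider_verts (c # Ls @ replicate t 1))
        (spider_edges (c # Ls @ replicate t 1)) f \<and> f Hub = 1"
      unfolding lengths by blast
  qed
qed

end
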